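(* Fix $t>0$, $x_0\in\mathbb{R}$, $\mu\in\mathbb{R}$ and $\sigma>0$ with $x_0\neq\mu$. For $\theta>0$ let $\gamma_{\theta}$ be the Gaussian probability measure on $\mathbb{R}$ with mean $m_t=x_0e^{-\theta t}+\mu(1-e^{-\theta t})$ and variance $\sigma_t^2=\frac{\sigma^2}{2\theta}\left(1-e^{-2\theta t}\right)$. For $n\in\mathbb{N}$ define $T_n^{**}:\mathbb{R}^n\to\mathbb{R}$ by $$T_n^{**}(z_1,\dots,z_n)=-\frac1t\ln\left(\frac{\frac{\sum_{k=1}^n z_k}{n}-\mu}{x_0-\mu}\right).$$ Then the estimators $T_{**}^{(0)}:\mathbb{R}^{\infty}\to\mathbb{R}$ and $T_{**}^{(1)}:\mathbb{R}^{\infty}\to\mathbb{R}$ defined by $$T_{**}^{(0)}((z_k)_{k\in\mathbb{N}})=\liminf_{n\to\infty}T_n^{**}(z_1,\dots,z_n)\quad\text{and}\quad T_{**}^{(1)}((z_k)_{k\in\mathbb{N}})=\limsup_{n\to\infty}T_n^{**}(z_1,\dots,z_n)$$ are infinite-sample consistent estimators of the parameter $\theta$ (the rate) for the family of probability measures $(\gamma_{\theta}^{\infty})_{\theta>0}$.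
   Context: $\mathbb{R}^\infty=\mathbb{R}^{\mathbb{N}}$ is the space of real sequences $(z_k)_{k\in\mathbb{N}}$, $\mathbb{N}=\{1,2,\dots\}$, with its Borel $\sigma$-algebra; for a Borel probability measure $\gamma$ on $\mathbb{R}$, $\gamma^{\infty}$ denotes the infinite product measure $\gamma\times\gamma\times\cdots$ on $\mathbb{R}^\infty$. Given a family $(\gamma_\vartheta)_{\vartheta\in\Theta}$ of Borel probability measures on $\mathbb{R}$ with $\Theta\subseteq\mathbb{R}$, a Borel measurable function $T:\mathbb{R}^\infty\to\mathbb{R}$ is called an infinite-sample consistent estimator of the parameter $\vartheta$ for the family $(\gamma_\vartheta^\infty)_{\vartheta\in\Theta}$ if $\gamma_\vartheta^\infty(\{(z_k)_{k\in\mathbb{N}}\in\mathbb{R}^\infty: T((z_k)_{k\in\mathbb{N}})=\vartheta\})=1$ for every $\vartheta\in\Theta$. (The measure $\gamma_{\theta}$ is the law at time $t$ of the Ornstein-Uhlenbeck process $x_t=x_0e^{-\theta t}+\mu(1-e^{-\theta t})+\sigma\int_0^te^{-\theta(t-s)}dW_s$ with $W$ a Wiener process; the claim only uses $\gamma_{\theta}$ as defined in it.) *)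

theory Defs
  imports "HOL-Probability.Probability"
begin

text \<open>
  The space of real sequences is the type \<^typ>\<open>nat \<Rightarrow> real\<close> with the Borel sets of its product
  topology. Sequences are indexed from 0, so \<open>z k\<close> stands for the (k+1)-st entry and
  \<open>z 0, \<dots>, z (n - 1)\<close> are the first n entries.
\<close>

definition seq_measure :: "real measure \<Rightarrow> (nat \<Rightarrow> real) measure" where
  "seq_measure \<gamma> = (\<Pi>\<^sub>M k\<in>(UNIV :: nat set). \<gamma>)"

definition infinite_sample_consistent ::
  "real set \<Rightarrow> (real \<Rightarrow> real measure) \<Rightarrow> ((nat \<Rightarrow> real) \<Rightarrow> real) \<Rightarrow> bool" where
  "infinite_sample_consistent \<Theta> \<gamma> T \<longleftrightarrow>
     (\<forall>\<theta>\<in>\<Theta>. prob_space (\<gamma> \<theta>) \<and> sets (\<gamma> \<theta>) = sets borel) \<and>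
     T \<in> borel_measurable borel \<and>
     (\<forall>\<theta>\<in>\<Theta>. measure (seq_measure (\<gamma> \<theta>)) {z. T z = \<theta>} = 1)"

definition ou_mean :: "real \<Rightarrow> real \<Rightarrow> real \<Rightarrow> real \<Rightarrow> real" where
  "ou_mean t x0 \<mu> \<theta> = x0 * exp (- \<theta> * t) + \<mu> * (1 - exp (- \<theta> * t))"

definition ou_variance :: "real \<Rightarrow> real \<Rightarrow> real \<Rightarrow> real" where
  "ou_variance t \<sigma> \<theta> = \<sigma>\<^sup>2 / (2 * \<theta>) * (1 - exp (- 2 * \<theta> * t))"

text \<open>
  The second parameter of \<^const>\<open>normal_density\<close> is the standard deviation.
\<close>

definition ou_law :: "real \<Rightarrow> real \<Rightarrow> real \<Rightarrow> real \<Rightarrow> real \<Rightarrow> real measure" where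
  "ou_law t x0 \<mu> \<sigma> \<theta> =
     density lborel (normal_density (ou_mean t x0 \<mu> \<theta>) (sqrt (ou_variance t \<sigma> \<theta>)))"

text \<open>
  The estimator depends only on the first n entries of z. Where the argument of the logarithm
  is not positive, the value is the one given by the total function \<^term>\<open>ln :: real \<Rightarrow> real\<close>,
  i.e. \<open>ln 0 = 0\<close> and \<open>ln (- x) = ln x\<close>; the value at \<open>n = 0\<close> is irrelevant for the limits below.
\<close>

definition rate_estimator :: "real \<Rightarrow> real \<Rightarrow> real \<Rightarrow> nat \<Rightarrow> (nat \<Rightarrow> real) \<Rightarrow> real" where
  "rate_estimator t x0 \<mu> n z = - (1 / t) * ln (((\<Sum>k<n. z k) / real n - \<mu>) / (x0 - \<mu>))"

text \<open>
  The lower and upper limits are taken in the extended reals; \<^const>\<open>real_of_ereal\<close> maps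
  infinite values to 0, which makes the estimators total and real-valued.
\<close>

definition rate_estimator_liminf :: "real \<Rightarrow> real \<Rightarrow> real \<Rightarrow> (nat \<Rightarrow> real) \<Rightarrow> real" where
  "rate_estimator_liminf t x0 \<mu> z =
     real_of_ereal (liminf (\<lambda>n. ereal (rate_estimator t x0 \<mu> n z)))"

definition rate_estimator_limsup :: "real \<Rightarrow> real \<Rightarrow> real \<Rightarrow> (nat \<Rightarrow> real) \<Rightarrow> real" where
  "rate_estimator_limsup t x0 \<mu> z =
     real_of_ereal (limsup (\<lambda>n. ereal (rate_estimator t x0 \<mu> n z)))"

end

theory Submission
  imports Defs
begin

text \<open>
  The sample mean of n independent normal variables with parameters \<open>\<mu>, \<sigma>\<close> is normal with
  parameters \<open>\<mu>, \<sigma> / sqrt n\<close>, so its fourth central moment is \<open>3 \<sigma>\<^sup>4 / n\<^sup>2\<close>, which is summable.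
  Hence the series of the fourth powers of the deviations has finite expectation and converges
  almost surely, and the sample means tend to \<open>\<mu>\<close>. The estimator is a function of the sample mean
  that is continuous at \<open>ou_mean\<close>, with value \<open>\<theta>\<close> there; so it converges almost surely to \<open>\<theta>\<close>,
  and both its lower and its upper limit equal \<open>\<theta>\<close>.
\<close>

text \<open>Means and variances add under independent summation; division by \<open>n\<close> is
  then an affine map.\<close>

lemma (in prob_space) distributed_normal_sample_mean:
  fixes X :: "nat \<Rightarrow> 'a \<Rightarrow> real"
  assumes indep: "indep_vars (\<lambda>_. borel) X UNIV" and "\<sigma> > 0" and "n > 0"
    and X: "\<And>k. distributed M lborel (X k) (normal_density \<mu> \<sigma>)"
  shows "distributed M lborel (\<lambda>\<omega>. (\<Sum>k<n. X k \<omega>) / real n)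
    (normal_density \<mu> (\<sigma> / sqrt (real n)))"
proof -
  have "distributed M lborel (\<lambda>\<omega>. \<Sum>k<n. X k \<omega>)
      (normal_density (\<Sum>k<n. \<mu>) (sqrt (\<Sum>k<n. \<sigma>\<^sup>2)))"
    using assms by (intro sum_indep_normal indep_vars_subset[OF indep]) auto
  then have "distributed M lborel (\<lambda>\<omega>. \<Sum>k<n. X k \<omega>)
      (normal_density (real n * \<mu>) (sqrt (real n) * \<sigma>))"
    using \<open>\<sigma> > 0\<close> by (simp add: real_sqrt_mult)
  from normal_density_affine[OF this, of "1 / real n" 0] assms
  have "distributed M lborel (\<lambda>\<omega>. (\<Sum>k<n. X k \<omega>) / real n)
      (normal_density \<mu> (sqrt (real n) * \<sigma> / real n))"
    by simp
  also have "sqrt (real n) * \<sigma> / real n = \<sigma> / sqrt (real n)"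
    using \<open>n > 0\<close> by (simp add: field_simps)
  finally show ?thesis .
qed

text \<open>The fourth power is used because the variances \<open>\<sigma>\<^sup>2 / n\<close> of
  the sample means are not summable, whereas the fourth central moments decay like
  \<open>1 / n\<^sup>2\<close>.\<close>

lemma (in prob_space) strong_law_normal:
  fixes X :: "nat \<Rightarrow> 'a \<Rightarrow> real"
  assumes indep: "indep_vars (\<lambda>_. borel) X UNIV" and "\<sigma> > 0"
    and X: "\<And>k. distributed M lborel (X k) (normal_density \<mu> \<sigma>)"
  shows "AE \<omega> in M. (\<lambda>n. (\<Sum>k<n. X k \<omega>) / real n) \<longlonglongrightarrow> \<mu>"
proof -
  \<comment> \<open>The index is shifted by one so that every mean is over a nonempty sample and its
    standard deviation is positive; \<open>LIMSEQ_imp_Suc\<close> undoes the shift at the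
    end.\<close>
  define A where "A n \<omega> = (\<Sum>k<Suc n. X k \<omega>) / real (Suc n)" for n \<omega>
  have [measurable]: "random_variable borel (X k)" for k
    using distributed_measurable[OF X[of k]] by simp
  have [measurable]: "A n \<in> borel_measurable M" for n
    unfolding A_def by measurable
  have moment: "(\<integral>\<^sup>+\<omega>. ennreal ((A n \<omega> - \<mu>) ^ 4) \<partial>M) = ennreal (3 * \<sigma> ^ 4 / (real (Suc n))\<^sup>2)" for n
  proof -
    let ?\<tau> = "\<sigma> / sqrt (real (Suc n))"
    have "?\<tau> > 0" using \<open>\<sigma> > 0\<close> by simp
    have "(\<integral>\<^sup>+\<omega>. ennreal ((A n \<omega> - \<mu>) ^ 4) \<partial>M) =
        (\<integral>\<^sup>+x. ennreal (normal_density \<mu> ?\<tau> x) * ennreal ((x - \<mu>) ^ 4) \<partial>lborel)"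
      unfolding A_def
      by (rule distributed_nn_integral[OF distributed_normal_sample_mean, symmetric])
        (use assms in auto)
    also have "\<dots> = (\<integral>\<^sup>+x. ennreal (normal_density \<mu> ?\<tau> x * (x - \<mu>) ^ (2 * 2)) \<partial>lborel)"
      by (simp add: ennreal_mult')
    \<comment> \<open>This is the formula for central moments of order \<open>2 * k\<close> with
      \<open>k = 2\<close>; its value is
      \<open>24 * ?\<tau> ^ 4 / 8 = 3 * ?\<tau> ^ 4\<close>.\<close>
    also have "\<dots> = ennreal (fact (2 * 2) / ((2 / ?\<tau>\<^sup>2) ^ 2 * fact 2))"
      using normal_moment_even[OF \<open>?\<tau> > 0\<close>, of \<mu> 2]
      by (subst nn_integral_eq_integral)
        (auto simp only: has_bochner_integral_iff intro!: AE_I2 mult_nonneg_nonneg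
          normal_density_nonneg zero_le_even_power dvd_triv_left)
    also have "fact (2 * 2) / ((2 / ?\<tau>\<^sup>2) ^ 2 * fact 2) = 3 * \<sigma> ^ 4 / (real (Suc n))\<^sup>2"
      by (simp add: fact_numeral power_divide field_simps)
        (simp add: power2_eq_square algebra_simps)
    finally show ?thesis .
  qed
  have "summable (\<lambda>n. 3 * \<sigma> ^ 4 * inverse ((real (Suc n))\<^sup>2))"
    using inverse_power_summable[of 2, where 'a = real]
    by (intro summable_mult)
      (simp only: summable_Suc_iff[where f = "\<lambda>n. inverse ((real n)\<^sup>2)"] order_refl)
  then have sm: "summable (\<lambda>n. 3 * \<sigma> ^ 4 / (real (Suc n))\<^sup>2)"
    by (simp add: divide_inverse)
  \<comment> \<open>The terms are nonnegative, so sum and expectation may be exchanged; a finite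
    expectation forces the series to be finite almost surely.\<close>
  have "(\<integral>\<^sup>+\<omega>. (\<Sum>n. ennreal ((A n \<omega> - \<mu>) ^ 4)) \<partial>M) = (\<Sum>n. ennreal (3 * \<sigma> ^ 4 / (real (Suc n))\<^sup>2))"
    by (subst nn_integral_suminf) (simp_all only: moment, measurable)
  also have "\<dots> \<noteq> \<infinity>"
    using sm by (subst suminf_ennreal2) auto
  finally have "AE \<omega> in M. (\<Sum>n. ennreal ((A n \<omega> - \<mu>) ^ 4)) \<noteq> \<infinity>"
    by (intro nn_integral_noteq_infinite) auto
  then show ?thesis
  proof eventually_elim
    case (elim \<omega>)
    then have "summable (\<lambda>n. (A n \<omega> - \<mu>) ^ 4)"
      by (intro summable_suminf_not_top) auto
    then have "(\<lambda>n. (A n \<omega> - \<mu>) ^ 4) \<longlonglongrightarrow> 0"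
      by (rule summable_LIMSEQ_zero)
    \<comment> \<open>Continuity of the fourth root at 0 passes from the fourth powers to the
      absolute deviations.\<close>
    moreover have "root 4 (x ^ 4) = \<bar>x\<bar>" for x :: real
      using real_root_power_cancel[of 4 "\<bar>x\<bar>"] by simp
    ultimately have "(\<lambda>n. \<bar>A n \<omega> - \<mu>\<bar>) \<longlonglongrightarrow> 0"
      using tendsto_real_root[of "\<lambda>n. (A n \<omega> - \<mu>) ^ 4" 0 sequentially 4] by simp
    then have "(\<lambda>n. A n \<omega> - \<mu>) \<longlonglongrightarrow> 0"
      by (rule tendsto_rabs_zero_cancel)
    then have "(\<lambda>n. A n \<omega>) \<longlonglongrightarrow> \<mu>"
      by (rule LIM_zero_cancel)
    then show ?case
      unfolding A_def by (rule LIMSEQ_imp_Suc)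
  qed
qed

text \<open>Independence means that the joint law is the product of the marginals. Here the joint
  law is the image of the product measure under the identity, and the marginals are its
  factors.\<close>

lemma indep_vars_PiM_coordinates:
  assumes "I \<noteq> {}" and "\<And>i. i \<in> I \<Longrightarrow> prob_space (N i)"
  shows "prob_space.indep_vars (Pi\<^sub>M I N) N (\<lambda>i z. z i) I"
proof -
  interpret P: prob_space "Pi\<^sub>M I N"
    using assms(2) by (rule prob_space_PiM)
  \<comment> \<open>Points of the product space are extensional, so restricting them to
    \<open>I\<close> changes nothing.\<close>
  have "distr (Pi\<^sub>M I N) (Pi\<^sub>M I N) (\<lambda>z. \<lambda>i\<in>I. z i) = distr (Pi\<^sub>M I N) (Pi\<^sub>M I N) (\<lambda>z. z)"
    by (intro distr_cong) (auto simp: space_PiM)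
  also have "\<dots> = Pi\<^sub>M I N"
    by (rule distr_id)
  also have "\<dots> = (\<Pi>\<^sub>M i\<in>I. distr (Pi\<^sub>M I N) (N i) (\<lambda>z. z i))"
    using assms by (intro PiM_cong) (simp_all add: distr_PiM_component)
  finally show ?thesis
    using assms(1) by (subst P.indep_vars_iff_distr_eq_PiM') auto
qed

text \<open>For countably many real coordinates the product \<sigma>-algebra is the Borel
  \<sigma>-algebra of the product topology. This makes events of a Borel estimator measurable for
  the product measure.\<close>

lemma sets_seq_measure:
  assumes "sets \<gamma> = sets borel"
  shows "sets (seq_measure \<gamma>) = sets borel"
  unfolding seq_measure_def sets_PiM_equal_borel[symmetric]
  using assms by (intro sets_PiM_cong) auto

lemma AE_seq_measure_normal_sample_mean:
  assumes "\<sigma> > 0"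
  shows "AE z in seq_measure (density lborel (normal_density \<mu> \<sigma>)).
    (\<lambda>n. (\<Sum>k<n. z k) / real n) \<longlonglongrightarrow> \<mu>"
proof -
  define \<gamma> where "\<gamma> = density lborel (normal_density \<mu> \<sigma>)"
  interpret \<gamma>: prob_space \<gamma>
    unfolding \<gamma>_def using assms by (rule prob_space_normal_density)
  interpret S: prob_space "seq_measure \<gamma>"
    unfolding seq_measure_def by (intro prob_space_PiM \<gamma>.prob_space_axioms)
  have sets_\<gamma> [measurable_cong, simp]: "sets \<gamma> = sets borel" "sets \<gamma> = sets lborel"
    by (simp_all add: \<gamma>_def)
  have "S.indep_vars (\<lambda>_. \<gamma>) (\<lambda>k z. z k) UNIV"
    unfolding seq_measure_def
    by (intro indep_vars_PiM_coordinates \<gamma>.prob_space_axioms) simp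
  then have "S.indep_vars (\<lambda>_. borel) (\<lambda>k z. z k) UNIV"
    by (rule S.indep_vars_compose2[where Y = "\<lambda>_ x. x"]) measurable
  moreover have "distributed (seq_measure \<gamma>) lborel (\<lambda>z. z k) (normal_density \<mu> \<sigma>)" for k
  proof -
    \<comment> \<open>Only the measurable sets of the target of \<open>distr\<close> matter, and
      \<open>lborel\<close> and \<open>\<gamma>\<close> share them.\<close>
    have "distr (seq_measure \<gamma>) lborel (\<lambda>z. z k) = distr (seq_measure \<gamma>) \<gamma> (\<lambda>z. z k)"
      by (intro distr_cong) auto
    also have "\<dots> = \<gamma>"
      unfolding seq_measure_def by (intro distr_PiM_component \<gamma>.prob_space_axioms) simp
    finally show ?thesis
      unfolding distributed_def by (simp add: \<gamma>_def seq_measure_def)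
  qed
  ultimately show ?thesis
    unfolding \<gamma>_def[symmetric] using assms by (intro S.strong_law_normal)
qed

lemma ou_variance_pos:
  assumes "t > 0" and "\<sigma> > 0" and "\<theta> > 0"
  shows "ou_variance t \<sigma> \<theta> > 0"
  using assms by (simp add: ou_variance_def)

text \<open>The estimator inverts \<theta> \<mapsto> \<open>ou_mean t x0 \<mu> \<theta>\<close>. The
  argument of \<open>ln\<close> tends to \<open>exp (- \<theta> * t) > 0\<close>, so its values at
  nonpositive arguments affect only finitely many \<open>n\<close>.\<close>

lemma rate_estimator_tendsto:
  assumes "t > 0" and "x0 \<noteq> \<mu>"
    and "(\<lambda>n. (\<Sum>k<n. z k) / real n) \<longlonglongrightarrow> ou_mean t x0 \<mu> \<theta>"
  shows "(\<lambda>n. rate_estimator t x0 \<mu> n z) \<longlonglongrightarrow> \<theta>"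
proof -
  have q: "(ou_mean t x0 \<mu> \<theta> - \<mu>) / (x0 - \<mu>) = exp (- \<theta> * t)"
    using assms(2) by (simp add: ou_mean_def field_simps)
  have "(\<lambda>n. ((\<Sum>k<n. z k) / real n - \<mu>) / (x0 - \<mu>)) \<longlonglongrightarrow> exp (- \<theta> * t)"
    unfolding q[symmetric] using assms by (intro tendsto_intros) auto
  then have "(\<lambda>n. rate_estimator t x0 \<mu> n z) \<longlonglongrightarrow> - (1 / t) * ln (exp (- \<theta> * t))"
    unfolding rate_estimator_def by (intro tendsto_mult tendsto_const tendsto_ln) auto
  then show ?thesis
    using assms(1) by simp
qed

lemma rate_estimator_measurable [measurable]:
  "rate_estimator t x0 \<mu> n \<in> borel_measurable borel"
proof -
  have [measurable]: "(\<lambda>z :: nat \<Rightarrow> real. z k) \<in> borel_measurable borel" for k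
    by (intro borel_measurable_continuous_onI continuous_on_product_coordinates)
  show ?thesis
    unfolding rate_estimator_def by measurable
qed

text \<open>Treats lower and upper limit together: all that is asked of \<open>T\<close>, besides
  measurability, is to return the limit of the estimates wherever it exists and is positive.\<close>

lemma infinite_sample_consistent_if_tendsto:
  assumes T: "T \<in> borel_measurable borel"
    and "\<And>z \<theta>. \<theta> > 0 \<Longrightarrow> (\<lambda>n. rate_estimator t x0 \<mu> n z) \<longlonglongrightarrow> \<theta> \<Longrightarrow> T z = \<theta>"
    and "t > 0" and "\<sigma> > 0" and "x0 \<noteq> \<mu>"
  shows "infinite_sample_consistent {0<..} (ou_law t x0 \<mu> \<sigma>) T"
proof -
  have "prob_space (ou_law t x0 \<mu> \<sigma> \<theta>) \<and> sets (ou_law t x0 \<mu> \<sigma> \<theta>) = sets borel \<and>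
      measure (seq_measure (ou_law t x0 \<mu> \<sigma> \<theta>)) {z. T z = \<theta>} = 1" if "\<theta> > 0" for \<theta>
  proof (intro conjI)
    let ?\<gamma> = "ou_law t x0 \<mu> \<sigma> \<theta>"
    have sd: "sqrt (ou_variance t \<sigma> \<theta>) > 0"
      using ou_variance_pos assms that by simp
    show \<gamma>: "prob_space ?\<gamma>"
      unfolding ou_law_def using sd by (rule prob_space_normal_density)
    show sets: "sets ?\<gamma> = sets borel"
      by (simp add: ou_law_def)
    interpret S: prob_space "seq_measure ?\<gamma>"
      unfolding seq_measure_def by (intro prob_space_PiM \<gamma>)
    have "AE z in seq_measure ?\<gamma>. (\<lambda>n. (\<Sum>k<n. z k) / real n) \<longlonglongrightarrow> ou_mean t x0 \<mu> \<theta>"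
      unfolding ou_law_def using sd by (rule AE_seq_measure_normal_sample_mean)
    then have "AE z in seq_measure ?\<gamma>. z \<in> {z. T z = \<theta>}"
      by eventually_elim (use assms that in \<open>auto intro: rate_estimator_tendsto\<close>)
    moreover have "{z. T z = \<theta>} \<in> sets (seq_measure ?\<gamma>)"
      unfolding sets_seq_measure[OF sets] using T by measurable
    ultimately show "measure (seq_measure ?\<gamma>) {z. T z = \<theta>} = 1"
      by (simp add: S.prob_eq_1)
  qed
  with T show ?thesis
    unfolding infinite_sample_consistent_def by auto
qed

theorem theorem3p3p1:
  fixes t x0 \<mu> \<sigma> :: real
  assumes "t > 0" and "\<sigma> > 0" and "x0 \<noteq> \<mu>"
  shows "infinite_sample_consistent {0<..} (ou_law t x0 \<mu> \<sigma>) (rate_estimator_liminf t x0 \<mu>) \<and>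
         infinite_sample_consistent {0<..} (ou_law t x0 \<mu> \<sigma>) (rate_estimator_limsup t x0 \<mu>)"
proof (intro conjI infinite_sample_consistent_if_tendsto assms)
  show "rate_estimator_liminf t x0 \<mu> \<in> borel_measurable borel"
    "rate_estimator_limsup t x0 \<mu> \<in> borel_measurable borel"
    unfolding rate_estimator_liminf_def rate_estimator_limsup_def by measurable
next
  fix z \<theta>
  assume "(\<lambda>n. rate_estimator t x0 \<mu> n z) \<longlonglongrightarrow> \<theta>"
  \<comment> \<open>The limit is finite in the extended reals, so the default 0 of
    \<open>real_of_ereal\<close> at infinite values does not arise here.\<close>
  then have "(\<lambda>n. ereal (rate_estimator t x0 \<mu> n z)) \<longlonglongrightarrow> ereal \<theta>"
    by simp
  then show "rate_estimator_liminf t x0 \<mu> z = \<theta>" "rate_estimator_limsup t x0 \<mu> z = \<theta>"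
    unfolding rate_estimator_liminf_def rate_estimator_limsup_def
    by (simp_all only: lim_imp_Liminf[OF sequentially_bot] lim_imp_Limsup[OF sequentially_bot]
        real_of_ereal.simps)
qed

end
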